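(* Let $a,b,n$ be integers such that $n \ge 2$, $a \ge \max(1,|b|)$, and $b \ge 0$ whenever $n$ is even. Set $\delta := \gcd(a,b)$, $\alpha := \delta^{-1} a$ and $\beta := \delta^{-1} b$. (i) Assume that $\beta \ne -\alpha$ when $n$ is odd. Then $n^a \mid a^n + b^n$ and $n^\alpha \mid \alpha^n + \beta^n$ if and only if $(a,b,n) = (2,1,3)$ or $(a,b,n) = (2^c,2^c,2)$ for some $c \in \{0,1,2\}$. (ii) Assume that $\beta \ne \alpha$. Then $n^a \mid a^n - b^n$ and $n^\alpha \mid \alpha^n - \beta^n$ if and only if $(a,b,n) = (3,1,2)$ or $(a,b,n) = (2,-1,3)$. *)

theory Defs
  imports Main
begin

end

theory Submission
  imports Defs "HOL-Number_Theory.Residues"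
begin

text \<open>
  For coprime \<open>\<alpha> > \<bar>\<beta>\<bar>\<close>, the smallest prime factor \<open>p\<close> of \<open>n\<close> divides \<open>\<alpha> - \<beta>\<close>.
  If \<open>p\<close> is odd, lifting the exponent turns \<open>n ^ \<alpha> dvd \<alpha> ^ n - \<beta> ^ n\<close> into
  \<open>p ^ (k * (\<alpha> - 1)) dvd \<alpha> - \<beta>\<close>, where \<open>k\<close> is the exponent of \<open>p\<close> in \<open>n\<close>; as
  \<open>\<alpha> - \<beta> \<le> 2 * \<alpha> - 1\<close>, only \<open>\<alpha> = 2\<close>, \<open>\<beta> = -1\<close>, \<open>p = 3\<close>, \<open>k = 1\<close> survives. If \<open>p = 2\<close>, the same
  argument for the squares leaves \<open>\<alpha> = 3\<close>, \<open>\<beta> = 1\<close>, \<open>k = 1\<close>. The cofactor of \<open>p\<close> in \<open>n\<close> is then 1,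
  because its smallest prime factor would divide \<open>(-2) ^ 3 - 1\<close> resp. \<open>3 ^ 2 - 1\<close>.
  Sums with \<open>n\<close> odd reduce to differences by \<open>\<beta> \<mapsto> -\<beta>\<close>; for \<open>n\<close> even, a sum of two coprime
  squares is not divisible by 4, so \<open>\<alpha> = 1\<close>. Finally, \<open>\<delta>\<close> is bounded by comparing the
  exponential with the polynomial growth in \<open>\<delta>\<close>.
\<close>

section \<open>Lifting the exponent\<close>

text \<open>The extra factor \<open>y\<close> avoids the truncated exponent \<open>i - 1\<close> in
  \<open>x ^ i \<equiv> y ^ i + i * (x - y) * y ^ (i - 1)\<close>.\<close>

lemma mult_geometric_sum_cong:
  fixes x y :: int and m :: nat
  assumes "d dvd x - y"
  shows "[y * (\<Sum>i<m. x ^ i * y ^ (m - Suc i)) = m * y ^ m + (x - y) * (\<Sum>i<m. int i) * y ^ (m - 1)] (mod d\<^sup>2)"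
proof -
  have pow: "[y * x ^ i = y ^ i * (y + int i * (x - y))] (mod d\<^sup>2)" for i
  proof (induction i)
    case (Suc i)
    have "[x * (y * x ^ i) = x * (y ^ i * (y + int i * (x - y)))] (mod d\<^sup>2)"
      using Suc by (rule cong_scalar_left)
    \<comment> \<open>Passing from \<open>i\<close> to \<open>i + 1\<close> leaves only a multiple
      of \<open>(x - y)^2\<close> as error.\<close>
    moreover have "d\<^sup>2 dvd y ^ i * int i * (x - y)\<^sup>2"
      using assms by (simp add: dvd_power_same)
    moreover have "x * (y ^ i * (y + int i * (x - y))) - y ^ Suc i * (y + int (Suc i) * (x - y))
        = y ^ i * int i * (x - y)\<^sup>2"
      by (simp add: algebra_simps power2_eq_square)
    ultimately have "[x * (y * x ^ i) = y ^ Suc i * (y + int (Suc i) * (x - y))] (mod d\<^sup>2)"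
      using cong_trans cong_iff_dvd_diff by metis
    then show ?case by (simp add: mult.left_commute)
  qed simp
  have "[(\<Sum>i<m. (y * x ^ i) * y ^ (m - Suc i)) =
         (\<Sum>i<m. (y ^ i * (y + int i * (x - y))) * y ^ (m - Suc i))] (mod d\<^sup>2)"
    by (intro cong_sum cong_scalar_right pow)
  also have "(\<Sum>i<m. (y ^ i * (y + int i * (x - y))) * y ^ (m - Suc i))
      = (\<Sum>i<m. y ^ m + (x - y) * y ^ (m - 1) * int i)"
  proof (rule sum.cong)
    fix i assume "i \<in> {..<m}"
    \<comment> \<open>An index below \<open>m\<close> forces \<open>m > 0\<close>, so
      \<open>m - 1\<close> is not truncated here.\<close>
    then have "y ^ i * y ^ (m - Suc i) = y ^ (m - 1)" "y ^ m = y * y ^ (m - 1)"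
      by (auto simp flip: power_add power_Suc)
    then show "(y ^ i * (y + int i * (x - y))) * y ^ (m - Suc i) = y ^ m + (x - y) * y ^ (m - 1) * int i"
      by (simp add: algebra_simps)
  qed simp
  also have "\<dots> = m * y ^ m + (x - y) * (\<Sum>i<m. int i) * y ^ (m - 1)"
    by (simp add: sum.distrib sum_distrib_left sum_distrib_right mult_ac)
  finally show ?thesis
    by (simp add: sum_distrib_left mult.assoc)
qed

text \<open>The upper bound in lifting the exponent, phrased by divisibility so that no valuation of
  a possibly zero difference is needed. A factor of \<open>m\<close> prime to \<open>p\<close>
  contributes no \<open>p\<close> to the quotient by \<open>x - y\<close>, and each factor
  \<open>p\<close> of \<open>m\<close> contributes exactly one.\<close>

lemma prime_power_dvd_power_diff:
  fixes x y :: int and p :: int and m e :: nat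
  assumes "prime p" "p dvd x - y" "p = 2 \<Longrightarrow> 4 dvd x - y" "\<not> p dvd y" "m > 0"
    and "p ^ e dvd x ^ m - y ^ m"
  shows "p ^ e dvd int m * (x - y)"
  using assms(2-)
proof (induction m arbitrary: x y e rule: less_induct)
  case (less m)
  note p = \<open>prime p\<close>
  have cop: "coprime y p"
    using p less.prems(3) by (meson coprime_commute prime_imp_coprime)
  define S where "S = (\<lambda>(x::int) y m. \<Sum>i<m. x ^ i * y ^ (m - Suc i))"
  have S: "x ^ k - y ^ k = (x - y) * S x y k" for x y k
    by (simp add: S_def power_diff_sumr2 mult_ac)
  show ?case
  proof (cases "p dvd int m")
    case False
    \<comment> \<open>As \<open>x\<close> and \<open>y\<close> agree modulo \<open>p\<close>,
      \<open>y * S x y m\<close> is congruent to \<open>m * y ^ m\<close>, a unit modulo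
      \<open>p\<close>.\<close>
    have "\<not> p dvd S x y m"
    proof
      assume "p dvd S x y m"
      then have "p dvd y * S x y m" by simp
      moreover have "[y * S x y m = int m * y ^ m + (x - y) * (\<Sum>i<m. int i) * y ^ (m - 1)] (mod p)"
        unfolding S_def using cong_dvd_modulus[OF mult_geometric_sum_cong[OF less.prems(1)]]
        by (simp add: power2_eq_square)
      ultimately have "p dvd int m * y ^ m + (x - y) * (\<Sum>i<m. int i) * y ^ (m - 1)"
        using cong_dvd_iff by blast
      then have "p dvd int m * y ^ m"
        using less.prems(1) by (simp add: dvd_add_left_iff)
      with False less.prems(3) show False
        using p prime_dvd_mult_iff prime_dvd_power by metis
    qed
    then have "coprime (p ^ e) (S x y m)"
      using p by (simp add: prime_imp_coprime)
    then show ?thesis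
      using less.prems(5) unfolding S by (simp add: coprime_dvd_mult_left_iff)
  next
    case True
    obtain q where q: "p = int q" by (metis p prime_ge_0_int zero_le_imp_eq_int)
    have "prime q" using p q by simp
    obtain l where l: "m = q * l" using True q by auto
    have "q > 1" "l > 0" using l less.prems(4) prime_gt_1_nat[OF \<open>prime q\<close>] by auto
    have "l < m" using l \<open>q > 1\<close> \<open>l > 0\<close> by simp
    define X Y where "X = x ^ l" and "Y = y ^ l"
    have xyXY: "x - y dvd X - Y" by (simp add: X_def Y_def S)
    then have pXY: "p dvd X - Y" using less.prems(1) by (rule dvd_trans[rotated])
    have copY: "coprime Y p" using cop by (simp add: Y_def)
    \<comment> \<open>For odd \<open>p\<close> the sum is \<open>q * (q - 1) / 2\<close>, so it
      supplies one factor \<open>p\<close> and \<open>X - Y\<close> the other. For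
      \<open>p = 2\<close> the sum is 1, and both factors must come from
      \<open>4 dvd x - y\<close>.\<close>
    have tri: "p\<^sup>2 dvd (X - Y) * (\<Sum>i<q. int i)"
    proof (cases "p = 2")
      case True
      then have "4 dvd X - Y" using less.prems(2) xyXY dvd_trans by blast
      then show ?thesis using True by simp
    next
      case False
      then have "odd q" using \<open>prime q\<close> q by (metis int_eq_iff_numeral prime_odd_nat \<open>q > 1\<close> le_neq_implies_less primes_dvd_imp_eq two_is_prime_nat)
      then obtain h where h: "q = 2 * h + 1" by (rule oddE)
      have "2 * (\<Sum>i<q. int i) = int q * (int q - 1)"
        by (induction q) (auto simp: algebra_simps)
      then have "(\<Sum>i<q. int i) = int q * int h" using h by simp
      then show ?thesis using pXY q by (simp add: power2_eq_square mult_dvd_mono)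
    qed
    have "[Y * S X Y q = int q * Y ^ q + (X - Y) * (\<Sum>i<q. int i) * Y ^ (q - 1)] (mod p\<^sup>2)"
      unfolding S_def by (rule mult_geometric_sum_cong[OF pXY])
    moreover have "[int q * Y ^ q + (X - Y) * (\<Sum>i<q. int i) * Y ^ (q - 1) = p * Y ^ q] (mod p\<^sup>2)"
      using tri q by (simp add: cong_iff_dvd_diff)
    ultimately have YS: "[Y * S X Y q = p * Y ^ q] (mod p\<^sup>2)" by (rule cong_trans)
    then have "p dvd Y * S X Y q"
      by (metis cong_dvd_iff cong_dvd_modulus dvd_triv_left power2_eq_square)
    then have "p dvd S X Y q" using copY by (simp add: coprime_dvd_mult_right_iff coprime_commute)
    then obtain u where u: "S X Y q = p * u" ..
    \<comment> \<open>Modulo the square of \<open>p\<close>, \<open>Y * S X Y q\<close> is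
      \<open>p * Y ^ q\<close> with \<open>Y\<close> prime to \<open>p\<close>, so
      \<open>S X Y q\<close> contains \<open>p\<close> exactly once.\<close>
    have "\<not> p dvd u"
    proof
      assume "p dvd u"
      then have "p\<^sup>2 dvd Y * S X Y q" by (simp add: u power2_eq_square)
      then have "p * p dvd p * Y ^ q" using YS by (simp add: cong_dvd_iff power2_eq_square)
      then have "p dvd Y ^ q" using p by (simp add: prime_gt_0_int)
      with copY p show False
        by (metis coprime_common_divisor dvd_refl not_prime_unit prime_dvd_power)
    qed
    then have cu: "coprime (p ^ e) u" using p by (simp add: prime_imp_coprime)
    have "x ^ m - y ^ m = ((X - Y) * p) * u"
      by (simp add: l X_def Y_def power_mult mult.commute[of q] S u[unfolded X_def Y_def])
    then have *: "p ^ e dvd (X - Y) * p" using less.prems(5) cu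
      by (simp add: coprime_dvd_mult_left_iff)
    show ?thesis
    \<comment> \<open>One \<open>p\<close> is cancelled, the induction hypothesis for
      \<open>l\<close> handles the rest, and \<open>m = q * l\<close> gives the \<open>p\<close>
      back.\<close>
    proof (cases e)
      case (Suc f)
      then have "p ^ f dvd X - Y" using * p by (simp add: mult.commute prime_gt_0_int)
      then have "p ^ f dvd int l * (x - y)"
        using less.IH[OF \<open>l < m\<close> less.prems(1-3) \<open>l > 0\<close>] by (simp add: X_def Y_def)
      then have "p * p ^ f dvd p * (int l * (x - y))" by (rule mult_dvd_mono[OF dvd_refl])
      then show ?thesis by (simp add: Suc l q mult.assoc)
    qed simp
  qed
qed

section \<open>Fermat's little theorem and the smallest prime factor\<close>

lemma fermat_theorem_int:
  fixes x :: int and p :: nat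
  assumes "prime p" "\<not> int p dvd x"
  shows "[x ^ (p - 1) = 1] (mod int p)"
proof -
  have p0: "p > 0" using assms(1) by (rule prime_gt_0_nat)
  define z where "z = nat (x mod int p)"
  have z: "int z = x mod int p" using p0 by (simp add: z_def)
  have "\<not> p dvd z" using assms(2) z by (metis dvd_mod_iff dvd_refl int_dvd_int_iff)
  then have "[z ^ (p - 1) = 1] (mod p)" using assms(1) by (intro fermat_theorem)
  then have "[int z ^ (p - 1) = 1] (mod int p)" by (metis cong_int_iff of_nat_1 of_nat_power)
  then show ?thesis by (simp add: z cong_def power_mod)
qed

text \<open>Since \<open>m\<close> is invertible modulo \<open>p - 1\<close>, raising to the power
  \<open>m\<close> is injective on the units modulo \<open>p\<close>; an inverse exponent
  \<open>u\<close> undoes it.\<close>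

lemma dvd_diff_if_dvd_power_diff:
  fixes x y :: int and p m :: nat
  assumes p: "prime p" "\<not> int p dvd x" "\<not> int p dvd y"
    and m: "coprime m (p - 1)" "m > 0" and dvd: "int p dvd x ^ m - y ^ m"
  shows "int p dvd x - y"
proof -
  obtain u v where uv: "m * u = (p - 1) * v + 1"
    using bezout_nat[of m "p - 1"] m by auto
  have red: "[z ^ (m * u) = z] (mod int p)" if "\<not> int p dvd z" for z :: int
  proof -
    have "[(z ^ (p - 1)) ^ v * z = 1 ^ v * z] (mod int p)"
      by (intro cong_scalar_right cong_pow fermat_theorem_int p(1) that)
    moreover have "z ^ (m * u) = (z ^ (p - 1)) ^ v * z"
      by (simp only: uv power_add power_mult power_one_right)
    ultimately show ?thesis by simp
  qed
  have "[(x ^ m) ^ u = (y ^ m) ^ u] (mod int p)"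
    using dvd by (rule cong_pow[OF cong_iff_dvd_diff[THEN iffD2]])
  then have "[x = y] (mod int p)"
    using red[OF p(2)] red[OF p(3)] by (metis cong_sym cong_trans power_mult)
  then show ?thesis by (simp add: cong_iff_dvd_diff)
qed

text \<open>For the smallest prime factor \<open>p\<close> of \<open>m\<close>, the order of \<open>x / y\<close> modulo \<open>p\<close> divides both
  \<open>m\<close> and \<open>p - 1\<close>, hence is 1.\<close>

lemma smallest_prime_factor_dvd_diff:
  fixes x y :: int and m :: nat
  assumes "coprime x y" "m > 1" "int m dvd x ^ m - y ^ m"
  obtains p where "prime p" "p dvd m" "int p dvd x - y" "\<not> int p dvd y"
proof -
  define p where "p = (LEAST q. prime q \<and> q dvd m)"
  have p: "prime p" "p dvd m"
    using LeastI_ex[of "\<lambda>q. prime q \<and> q dvd m"] prime_factor_nat[of m] assms(2)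
    by (auto simp: p_def)
  have least: "p \<le> q" if "prime q" "q dvd m" for q
    unfolding p_def using that by (intro Least_le) auto
  have dvd: "int p dvd x ^ m - y ^ m" using p(2) assms(3) by (meson dvd_trans int_dvd_int_iff)
  have pp: "prime (int p)" using p(1) by simp
  have "\<not> (int p dvd x \<and> int p dvd y)"
    using assms(1) pp by (metis coprime_common_divisor not_prime_unit)
  moreover have "int p dvd x \<longleftrightarrow> int p dvd y"
  proof -
    have "int p dvd x ^ m \<longleftrightarrow> int p dvd y ^ m"
      using dvd by (metis cong_dvd_iff cong_iff_dvd_diff)
    then show ?thesis using pp assms(2) by (simp add: prime_dvd_power_iff)
  qed
  ultimately have ndvd: "\<not> int p dvd x" "\<not> int p dvd y" by auto
  \<comment> \<open>A common prime factor would be a prime factor of \<open>m\<close> smaller than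
    \<open>p\<close>.\<close>
  have "coprime m (p - 1)"
  proof (rule ccontr)
    assume "\<not> coprime m (p - 1)"
    then obtain q where q: "prime q" "q dvd m" "q dvd p - 1"
      by (metis coprime_iff_gcd_eq_1 gcd_greatest_iff prime_factor_nat)
    have "q \<le> p - 1" using q(3) p(1) prime_gt_1_nat by (intro dvd_imp_le) auto
    then show False using least[OF q(1,2)] p(1) prime_gt_1_nat[of p] by linarith
  qed
  then have "int p dvd x - y"
    using dvd_diff_if_dvd_power_diff[OF p(1) ndvd] assms(2) dvd by simp
  with p ndvd(2) show thesis using that by blast
qed

section \<open>Coprime pairs\<close>

text \<open>Negative \<open>\<beta>\<close> is allowed, so that sums with odd exponent are covered
  after a change of sign.\<close>

lemma odd_coprime_case:
  fixes \<beta> :: int and A N :: nat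
  assumes "odd N" "N > 1" "coprime (int A) \<beta>" "\<bar>\<beta>\<bar> \<le> int A" "A > 0" "\<beta> \<noteq> int A"
    and dvd: "int N ^ A dvd int A ^ N - \<beta> ^ N"
  shows "A = 2 \<and> \<beta> = -1 \<and> N = 3"
proof -
  have N: "int N dvd int A ^ N - \<beta> ^ N"
    using dvd \<open>A > 0\<close> by (meson dvd_power dvd_trans)
  obtain p where p: "prime p" "p dvd N" "int p dvd int A - \<beta>" "\<not> int p dvd \<beta>"
    using smallest_prime_factor_dvd_diff[OF assms(3,2) N] by blast
  have "odd p" using p(2) assms(1) by auto
  then have p3: "p \<ge> 3" using p(1) prime_ge_2_nat[of p] by (cases "p = 2") auto
  obtain m where m: "N = p ^ multiplicity p N * m" "\<not> p dvd m"
    using multiplicity_decompose'[of N p] assms(2) p(1) by (metis not_prime_unit not_one_less_zero)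
  define k where "k = multiplicity p N"
  have k: "k > 0" using p assms(2) unfolding k_def
    by (simp add: prime_multiplicity_gt_zero_iff)
  have "int p ^ (k * A) dvd int N ^ A"
    by (subst m) (simp add: k_def power_mult power_mult_distrib)
  then have "int p ^ (k * A) dvd int A ^ N - \<beta> ^ N" using dvd dvd_trans by blast
  then have "int p ^ (k * A) dvd int N * (int A - \<beta>)"
    using p \<open>odd p\<close> assms(2) by (intro prime_power_dvd_power_diff) auto
  \<comment> \<open>The factor \<open>N\<close> accounts for \<open>p ^ k\<close>; the remaining
    exponent \<open>k * (A - 1)\<close> must be absorbed by \<open>A - \<beta>\<close>.\<close>
  moreover have "k * A = k + k * (A - 1)" using \<open>A > 0\<close> by (cases A) auto
  ultimately have "int p ^ k * int p ^ (k * (A - 1)) dvd int p ^ k * (int m * (int A - \<beta>))"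
    using m(1) by (metis k_def mult.assoc of_nat_mult of_nat_power power_add)
  then have "int p ^ (k * (A - 1)) dvd int m * (int A - \<beta>)"
    using p(1) by (simp add: prime_gt_0_nat)
  moreover have "coprime (int p ^ (k * (A - 1))) (int m)"
    using m(2) p(1) by (simp add: prime_imp_coprime)
  ultimately have main: "int p ^ (k * (A - 1)) dvd int A - \<beta>"
    by (simp add: coprime_dvd_mult_right_iff)
  \<comment> \<open>Otherwise coprimality gives \<open>A = 1\<close>, and the odd prime
    \<open>p\<close> divides 2.\<close>
  have "\<beta> \<noteq> - int A"
  proof
    assume *: "\<beta> = - int A"
    then have "A = 1" using assms(3) by simp
    with * have "int p dvd 2" using p(3) by simp
    then show False using p3 zdvd_imp_le by fastforce
  qed
  then have ub: "int A - \<beta> \<le> 2 * int A - 1" "int A - \<beta> > 0" using assms(4,6) by auto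
  have le: "int p ^ (k * (A - 1)) \<le> 2 * int A - 1"
    using zdvd_imp_le[OF main] ub by linarith
  have A1: "A \<noteq> 1"
  proof
    assume "A = 1"
    then have "\<beta> = 0" using assms(4) ub \<open>\<beta> \<noteq> int A\<close> by auto
    then show False using p(4) by simp
  qed
  \<comment> \<open>This is \<open>3 ^ (A - 1) > 2 * A - 1\<close> for \<open>A = j + 3\<close>; at
    \<open>A = 2\<close> both sides equal 3.\<close>
  have grow: "(3::int) ^ (j + 2) > 2 * (int j + 3) - 1" for j :: nat
    by (induction j) auto
  have mono: "(3::int) ^ (A - 1) \<le> int p ^ (k * (A - 1))" 
  proof -
    have "(3::int) ^ (A - 1) \<le> 3 ^ (k * (A - 1))" using k by (intro power_increasing) auto
    also have "\<dots> \<le> int p ^ (k * (A - 1))" using p3 by (intro power_mono) auto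
    finally show ?thesis .
  qed
  have A2: "A = 2"
  proof (rule ccontr)
    assume "A \<noteq> 2"
    then have "A \<ge> 3" using A1 \<open>A > 0\<close> by simp
    then obtain j where "A = j + 3" by (metis add.commute le_Suc_ex)
    then show False using grow[of j] mono le by simp
  qed
  have pk: "int p ^ k \<le> 3" using le A2 by simp
  have k1: "k = 1"
  proof (rule ccontr)
    assume "k \<noteq> 1"
    then have "(3::int) ^ 2 \<le> 3 ^ k" using k by (intro power_increasing) auto
    also have "\<dots> \<le> int p ^ k" using p3 by (intro power_mono) auto
    finally show False using pk by simp
  qed
  have pp: "p = 3" using pk p3 k1 by simp
  have "3 dvd 2 - \<beta>" using main A2 pp k1 by simp
  moreover have "-1 \<le> \<beta>" "\<beta> \<le> 1" using \<open>\<beta> \<noteq> - int A\<close> assms(4,6) A2 by auto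
  ultimately have b: "\<beta> = -1" by presburger
  have Nm: "N = 3 * m" using m(1) k1 pp by (simp add: k_def)
  have "m = 1"
  proof (rule ccontr)
    assume "m \<noteq> 1"
    then have "m > 1" using Nm assms(2) by (cases m) auto
    \<comment> \<open>Cubing 2 and -1 turns the exponent \<open>3 * m\<close> into \<open>m\<close>,
      so a smallest prime factor of \<open>m\<close> divides 9.\<close>
    have "int m dvd 8 ^ m - (-1) ^ m"
      using N A2 b Nm by (simp add: power_mult) (metis dvd_mult_right)
    then obtain q where q: "prime q" "q dvd m" "int q dvd 8 - (-1)"
      using smallest_prime_factor_dvd_diff[of 8 "-1" m] \<open>m > 1\<close> by auto
    then have "q dvd 3 * 3" by (simp add: int_dvd_int_iff[of q 9, simplified])
    then have "q = 3" using q(1) 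
      using prime_dvd_multD[of q 3 3] primes_dvd_imp_eq[of q 3] by auto
    then show False using m(2) q(2) pp by simp
  qed
  then show ?thesis using A2 b Nm by simp
qed

text \<open>For the prime 2, lifting the exponent needs a difference divisible by 4. Both
  \<open>A\<close> and \<open>\<beta>\<close> are odd, so the difference of their squares is a
  product of two even factors; hence squares with exponent \<open>N / 2\<close> are used.\<close>

lemma even_coprime_case:
  fixes \<beta> :: int and A N :: nat
  assumes "even N" "N > 1" "coprime (int A) \<beta>" "0 \<le> \<beta>" "\<beta> < int A"
    and dvd: "int N ^ A dvd int A ^ N - \<beta> ^ N"
  shows "A = 3 \<and> \<beta> = 1 \<and> N = 2"
proof -
  have "A > 0" using assms by simp
  then have N: "int N dvd int A ^ N - \<beta> ^ N"
    using dvd by (meson dvd_power dvd_trans)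
  have "even (int A ^ N - \<beta> ^ N)" using N assms(1) by (meson dvd_trans even_of_nat)
  then have par: "even A \<longleftrightarrow> even \<beta>" using assms(2) by simp
  then have odds: "odd A" "odd \<beta>" using assms(3) by (metis coprime_common_divisor even_of_nat odd_one)+
  obtain M where M: "N = 2 * M" using assms(1) by blast
  obtain m where m: "M = 2 ^ multiplicity 2 M * m" "\<not> 2 dvd m"
    using multiplicity_decompose'[of M 2] assms(2) M by auto
  define j where "j = multiplicity 2 M"
  define D where "D = (int A)\<^sup>2 - \<beta>\<^sup>2"
  have Nj: "N = 2 ^ Suc j * m" using M m by (simp add: j_def)
  have "(4::int) dvd D"
  proof -
    have "D = (int A - \<beta>) * (int A + \<beta>)" by (simp add: D_def algebra_simps power2_eq_square)
    moreover have "2 * 2 dvd (int A - \<beta>) * (int A + \<beta>)" using odds by (intro mult_dvd_mono) auto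
    ultimately show ?thesis by simp
  qed
  have "(2::int) ^ (Suc j * A) dvd int N ^ A"
    unfolding Nj by (simp add: power_mult power_mult_distrib del: power_Suc mult_Suc)
  then have "2 ^ (Suc j * A) dvd ((int A)\<^sup>2) ^ M - (\<beta>\<^sup>2) ^ M"
    using dvd dvd_trans M by (metis power_mult)
  then have "2 ^ (Suc j * A) dvd int M * D"
    unfolding D_def using \<open>4 dvd D\<close> odds assms(2) M
    by (intro prime_power_dvd_power_diff) (auto simp: D_def)
  \<comment> \<open>Here \<open>M\<close> accounts for only \<open>2 ^ j\<close>, although
    \<open>N\<close> contains \<open>2 ^ Suc j\<close>; this gains the extra 1 in the
    exponent.\<close>
  moreover have "Suc j * A = j + (Suc j * (A - 1) + 1)" using \<open>A > 0\<close> by (cases A) auto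
  ultimately have "2 ^ j * 2 ^ (Suc j * (A - 1) + 1) dvd 2 ^ j * (int m * D)"
    using m(1) by (metis j_def mult.assoc of_nat_mult of_nat_power of_nat_numeral power_add)
  then have "2 ^ (Suc j * (A - 1) + 1) dvd int m * D" by (subst (asm) dvd_mult_cancel_left) simp
  moreover have "coprime (2 ^ (Suc j * (A - 1) + 1)) (int m)"
    using m(2) by simp
  ultimately have main: "2 ^ (Suc j * (A - 1) + 1) dvd D"
    using coprime_dvd_mult_right_iff by blast
  have "\<beta> \<ge> 1" using odds(2) assms(4) by (cases "\<beta> = 0") auto
  then have "D \<le> (int A)\<^sup>2 - 1" by (simp add: D_def power2_eq_square)
  moreover have "D > 0" unfolding D_def using assms(4,5) by (simp add: power_strict_mono)
  ultimately have le: "2 ^ (Suc j * (A - 1) + 1) \<le> (int A)\<^sup>2 - 1"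
    using zdvd_imp_le[OF main] by linarith
  have "A \<ge> 3" using odds(1) \<open>\<beta> \<ge> 1\<close> assms(5) by (cases "A = 2") auto
  \<comment> \<open>The shift by 4 is sharp: at \<open>A = 3\<close> both sides equal 8.\<close>
  have grow: "(2::int) ^ (i + 4) > (int i + 4)\<^sup>2 - 1" for i :: nat
  proof (induction i)
    case (Suc i)
    have "(int (Suc i) + 4)\<^sup>2 - 1 \<le> 2 * ((int i + 4)\<^sup>2 - 1)"
      by (simp add: power2_eq_square algebra_simps)
    also have "\<dots> < 2 * 2 ^ (i + 4)" using Suc by simp
    also have "\<dots> = 2 ^ (Suc i + 4)" by (simp only: add_Suc power_Suc)
    finally show ?case .
  qed simp
  have "A = 3"
  proof (rule ccontr)
    assume "A \<noteq> 3"
    then have "A \<ge> 4" using \<open>A \<ge> 3\<close> by simp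
    then obtain i where i: "A = i + 4" by (metis add.commute le_Suc_ex)
    have "(2::int) ^ A \<le> 2 ^ (Suc j * (A - 1) + 1)" 
      using \<open>A > 0\<close> by (intro power_increasing) (cases A; simp)+
    then have "(2::int) ^ A \<le> (int A)\<^sup>2 - 1" using le by (rule order_trans)
    then show False using grow[of i] i by simp
  qed
  have "j = 0"
  proof (rule ccontr)
    assume "j \<noteq> 0"
    \<comment> \<open>With \<open>A = 3\<close> the exponent is at least \<open>2 * 2 + 1\<close>,
      while the upper bound is 8.\<close>
    then have "(2::int) ^ 5 \<le> 2 ^ (Suc j * (A - 1) + 1)" using \<open>A = 3\<close> by (intro power_increasing) auto
    then show False using le \<open>A = 3\<close> by simp
  qed
  then have "8 dvd D" using main \<open>A = 3\<close> by simp
  have b: "\<beta> = 1"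
  proof -
    have "\<beta> = 1 \<or> \<beta> = 2" using \<open>\<beta> \<ge> 1\<close> assms(5) \<open>A = 3\<close> by auto
    then show ?thesis using odds(2) by auto
  qed
  have Nm: "N = 2 * m" using Nj \<open>j = 0\<close> by simp
  have "m = 1"
  proof (rule ccontr)
    assume "m \<noteq> 1"
    then have "m > 1" using Nm assms(2) by (cases m) auto
    have "int m dvd 9 ^ m - 1 ^ m"
      using N \<open>A = 3\<close> b Nm by (simp add: power_mult) (metis dvd_mult_right)
    then obtain q where q: "prime q" "q dvd m" "int q dvd 9 - 1"
      using smallest_prime_factor_dvd_diff[of 9 1 m] \<open>m > 1\<close> by auto
    then have "q dvd 2 ^ 3" by (simp add: int_dvd_int_iff[of q 8, simplified])
    then have "q = 2" using q(1) by (metis prime_dvd_power primes_dvd_imp_eq two_is_prime_nat)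
    then show False using m(2) q(2) by simp
  qed
  then show ?thesis using \<open>A = 3\<close> b Nm by simp
qed

text \<open>The sum is one of two coprime squares, hence not divisible by 4, whereas
  \<open>N ^ A\<close> is divisible by 4 as soon as \<open>A\<close> is at least 2.\<close>

lemma even_coprime_sum_case:
  fixes \<beta> :: int and A N :: nat
  assumes "even N" "N > 1" "coprime (int A) \<beta>" "0 \<le> \<beta>" "\<beta> \<le> int A" "A > 0"
    and dvd: "int N ^ A dvd int A ^ N + \<beta> ^ N"
  shows "A = 1 \<and> \<beta> = 1 \<and> N = 2"
proof -
  have N: "int N dvd int A ^ N + \<beta> ^ N"
    using dvd \<open>A > 0\<close> by (meson dvd_power dvd_trans)
  obtain M where M: "N = 2 * M" using assms(1) by blast
  define x y where "x = int A ^ M" and "y = \<beta> ^ M"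
  have xy: "int A ^ N + \<beta> ^ N = x\<^sup>2 + y\<^sup>2" by (simp add: x_def y_def M power_mult mult.commute flip: power_mult)
  have cop: "coprime x y" using assms(3) by (simp add: x_def y_def)
  have n4: "\<not> 4 dvd x\<^sup>2 + y\<^sup>2"
  proof
    assume d: "4 dvd x\<^sup>2 + y\<^sup>2"
    have sq: "even z \<or> z\<^sup>2 mod 4 = 1" for z :: int
    proof (cases "even z")
      case False
      then obtain w where "z = 2 * w + 1" by (rule oddE)
      then have "z\<^sup>2 = 4 * (w\<^sup>2 + w) + 1" by (simp add: power2_eq_square algebra_simps)
      then show ?thesis by presburger
    qed simp
    have "even (x\<^sup>2 + y\<^sup>2)" using d dvd_trans[of 2 4 "x\<^sup>2 + y\<^sup>2"] by simp
    then have par: "even x \<longleftrightarrow> even y" by simp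
    then have "odd x" "odd y" using cop by (metis coprime_common_divisor odd_one)+
    then have "x\<^sup>2 mod 4 = 1" "y\<^sup>2 mod 4 = 1" using sq by auto
    then have "(x\<^sup>2 + y\<^sup>2) mod 4 = 2" by (simp flip: mod_add_eq)
    then show False using d by simp
  qed
  have A1: "A = 1"
  proof (rule ccontr)
    assume "A \<noteq> 1"
    then have "A \<ge> 2" using \<open>A > 0\<close> by simp
    then have "int N ^ 2 dvd int N ^ A" by (rule le_imp_power_dvd)
    moreover have "(4::int) dvd int N ^ 2" by (simp add: M power_mult_distrib)
    ultimately show False using n4 dvd xy by (metis dvd_trans)
  qed
  then have "\<beta> = 0 \<or> \<beta> = 1" using assms(4,5) by auto
  moreover have "\<beta> \<noteq> 0" using N A1 assms(2) by (auto simp: zero_power)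
  ultimately have b: "\<beta> = 1" by simp
  then have "int N dvd 2" using N A1 by simp
  then have "N \<le> 2" using zdvd_imp_le by fastforce
  then show ?thesis using A1 b assms(2) by simp
qed

section \<open>Bounding the common factor\<close>

text \<open>The divisibility for the coprime pair determines \<open>A\<close>,
  \<open>\<beta>\<close> and \<open>N\<close>; the one for the multiples by \<open>D\<close> then
  bounds \<open>D\<close>.\<close>

lemma dvd_power_diff_iff:
  fixes \<beta> :: int and A D N :: nat
  assumes "D > 0" "A > 0" "N > 1" "coprime (int A) \<beta>" "\<bar>\<beta>\<bar> \<le> int A" "even N \<Longrightarrow> 0 \<le> \<beta>" "\<beta> \<noteq> int A"
  shows "int N ^ (D * A) dvd (int D * int A) ^ N - (int D * \<beta>) ^ N \<and> int N ^ A dvd int A ^ N - \<beta> ^ N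
    \<longleftrightarrow> D = 1 \<and> (A = 3 \<and> \<beta> = 1 \<and> N = 2 \<or> A = 2 \<and> \<beta> = -1 \<and> N = 3)" (is "?L \<longleftrightarrow> ?R")
proof
  assume L: ?L
  have "A = 3 \<and> \<beta> = 1 \<and> N = 2 \<or> A = 2 \<and> \<beta> = -1 \<and> N = 3"
  proof (cases "even N")
    case True
    then show ?thesis using even_coprime_case[of N A \<beta>] assms L by simp
  next
    case False
    then show ?thesis using odd_coprime_case[of N A \<beta>] assms L by simp
  qed
  then show ?R
  proof
    assume *: "A = 3 \<and> \<beta> = 1 \<and> N = 2"
    \<comment> \<open>Here \<open>2 ^ (3 * D)\<close> divides the difference of the squares of
      \<open>3 * D\<close> and \<open>D\<close>.\<close>
    have "8 ^ D dvd 8 * (int D)\<^sup>2"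
      using L * by (simp add: power_mult_distrib mult.commute[of D] power_mult)
    then have le: "8 ^ D \<le> 8 * (int D)\<^sup>2" using \<open>D > 0\<close> by (intro zdvd_imp_le) auto
    have "8 * (int i + 2)\<^sup>2 < 8 ^ (i + 2)" for i :: nat
    proof (induction i)
      case (Suc i)
      have "8 * (int (Suc i) + 2)\<^sup>2 \<le> 8 * (8 * (int i + 2)\<^sup>2)"
        by (simp add: power2_eq_square algebra_simps)
      moreover have "(8::int) ^ (Suc i + 2) = 8 * 8 ^ (i + 2)" by (simp only: add_Suc power_Suc)
      ultimately show ?case using Suc by linarith
    qed simp
    note grow = this
    have "\<not> D \<ge> 2"
    proof
      assume "D \<ge> 2"
      then obtain i where "D = i + 2" by (metis add.commute le_Suc_ex)
      then show False using grow[of i] le by (simp add: add.commute)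
    qed
    then show ?R using * \<open>D > 0\<close> by simp
  next
    assume *: "A = 2 \<and> \<beta> = -1 \<and> N = 3"
    \<comment> \<open>Here \<open>3 ^ (2 * D)\<close> divides
      \<open>(2 * D) ^ 3 + D ^ 3\<close>.\<close>
    have "9 ^ D dvd 9 * (int D) ^ 3"
      using L * by (simp add: power_mult_distrib mult.commute[of D] power_mult)
    then have le: "9 ^ D \<le> 9 * (int D) ^ 3" using \<open>D > 0\<close> by (intro zdvd_imp_le) auto
    have "9 * (int i + 2) ^ 3 < 9 ^ (i + 2)" for i :: nat
    proof (induction i)
      case (Suc i)
      have "9 * (int (Suc i) + 2) ^ 3 \<le> 9 * (9 * (int i + 2) ^ 3)"
        by (simp add: power3_eq_cube algebra_simps)
      moreover have "(9::int) ^ (Suc i + 2) = 9 * 9 ^ (i + 2)" by (simp only: add_Suc power_Suc)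
      ultimately show ?case using Suc by linarith
    qed simp
    note grow = this
    have "\<not> D \<ge> 2"
    proof
      assume "D \<ge> 2"
      then obtain i where "D = i + 2" by (metis add.commute le_Suc_ex)
      then show False using grow[of i] le by (simp add: add.commute)
    qed
    then show ?R using * \<open>D > 0\<close> by simp
  qed
qed auto

lemma dvd_power_sum_even_iff:
  fixes \<beta> :: int and A D N :: nat
  assumes "D > 0" "A > 0" "N > 1" "coprime (int A) \<beta>" "\<beta> \<le> int A" "even N" "0 \<le> \<beta>"
  shows "int N ^ (D * A) dvd (int D * int A) ^ N + (int D * \<beta>) ^ N \<and> int N ^ A dvd int A ^ N + \<beta> ^ N
    \<longleftrightarrow> D \<in> {1, 2, 4} \<and> A = 1 \<and> \<beta> = 1 \<and> N = 2" (is "?L \<longleftrightarrow> ?R")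
proof
  assume L: ?L
  have *: "A = 1 \<and> \<beta> = 1 \<and> N = 2"
    using even_coprime_sum_case[of N A \<beta>] assms L by simp
  have dvd: "2 ^ D dvd 2 * (int D)\<^sup>2" using L * by simp
  then have le: "2 ^ D \<le> 2 * (int D)\<^sup>2" using \<open>D > 0\<close> by (intro zdvd_imp_le) auto
  \<comment> \<open>The growth argument starts only at 7, since at 6 it fails: 72 exceeds
    64.\<close>
  have "2 * (int i + 7)\<^sup>2 < 2 ^ (i + 7)" for i :: nat
  proof (induction i)
    case (Suc i)
    have "2 * (int (Suc i) + 7)\<^sup>2 \<le> 2 * (2 * (int i + 7)\<^sup>2)"
      by (simp add: power2_eq_square algebra_simps)
    moreover have "(2::int) ^ (Suc i + 7) = 2 * 2 ^ (i + 7)" by (simp only: add_Suc power_Suc)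
    ultimately show ?case using Suc by linarith
  qed simp
  note grow = this
  have "\<not> D \<ge> 7"
  proof
    assume "D \<ge> 7"
    then obtain i where "D = i + 7" by (metis add.commute le_Suc_ex)
    then show False using grow[of i] le by (simp add: add.commute)
  qed
  \<comment> \<open>Of these, 3, 5 and 6 fail the divisibility itself: 8, 32 and 64 do not divide
    18, 50 and 72.\<close>
  then have "D \<in> {1, 2, 3, 4, 5, 6}" using \<open>D > 0\<close> by auto
  then show ?R using dvd * by auto
qed auto

section \<open>Passage to natural numbers and the two statements\<close>

theorem theorem1:
  fixes a b n \<delta> \<alpha> \<beta> :: int
  assumes "n \<ge> 2"
    and "a \<ge> max 1 \<bar>b\<bar>"
    and "even n \<Longrightarrow> b \<ge> 0"
    and "\<delta> = gcd a b"
    and "\<alpha> = a div \<delta>"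
    and "\<beta> = b div \<delta>"
  shows "((odd n \<longrightarrow> \<beta> \<noteq> - \<alpha>) \<longrightarrow>
           (n ^ nat a dvd a ^ nat n + b ^ nat n \<and> n ^ nat \<alpha> dvd \<alpha> ^ nat n + \<beta> ^ nat n
             \<longleftrightarrow> (a, b, n) = (2, 1, 3) \<or> (\<exists>c\<in>{0, 1, 2 :: nat}. (a, b, n) = (2 ^ c, 2 ^ c, 2)))) \<and>
         (\<beta> \<noteq> \<alpha> \<longrightarrow>
           (n ^ nat a dvd a ^ nat n - b ^ nat n \<and> n ^ nat \<alpha> dvd \<alpha> ^ nat n - \<beta> ^ nat n
             \<longleftrightarrow> (a, b, n) = (3, 1, 2) \<or> (a, b, n) = (2, -1, 3)))"
proof -
  have "a \<ge> 1" "\<bar>b\<bar> \<le> a" using assms(2) by auto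
  have "\<delta> > 0" using assms(4) \<open>a \<ge> 1\<close> by simp
  have a: "a = \<delta> * \<alpha>" and b: "b = \<delta> * \<beta>" using assms(4-6) by simp_all
  have "\<alpha> > 0" using a \<open>a \<ge> 1\<close> \<open>\<delta> > 0\<close> by (metis less_le_trans zero_less_mult_pos zero_less_one)
  have cop: "coprime \<alpha> \<beta>" using assms(4-6) \<open>a \<ge> 1\<close> by (simp add: div_gcd_coprime)
  have "\<delta> * \<bar>\<beta>\<bar> \<le> \<delta> * \<alpha>" using \<open>\<bar>b\<bar> \<le> a\<close> a b \<open>\<delta> > 0\<close> by (simp add: abs_mult)
  then have bnd: "\<bar>\<beta>\<bar> \<le> \<alpha>" using \<open>\<delta> > 0\<close> by simp
  have ev: "0 \<le> \<beta>" if "even n" using assms(3)[OF that] b \<open>\<delta> > 0\<close> by (simp add: zero_le_mult_iff)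
  obtain D A N where DAN: "\<delta> = int D" "\<alpha> = int A" "n = int N"
    using zero_le_imp_eq_int[of \<delta>] zero_le_imp_eq_int[of \<alpha>] zero_le_imp_eq_int[of n]
      \<open>\<delta> > 0\<close> \<open>\<alpha> > 0\<close> assms(1) by auto
  have pos: "D > 0" "A > 0" "N > 1" using \<open>\<delta> > 0\<close> \<open>\<alpha> > 0\<close> assms(1) DAN by auto
  have na: "nat a = D * A" "nat \<alpha> = A" "nat n = N" by (simp_all add: a DAN nat_mult_distrib)
  note cop' = cop[unfolded DAN] and bnd' = bnd[unfolded DAN] and ev' = ev[unfolded DAN even_of_nat]
  \<comment> \<open>In the sporadic solutions \<open>b\<close> is 1 or -1, which forces the gcd to
    be 1.\<close>
  have unit: "D = 1" if "int D * z = 1 \<or> int D * z = -1" for z :: int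
  proof -
    have "\<bar>int D * z\<bar> = 1" using that by auto
    then show ?thesis using abs_zmult_eq_1 by fastforce
  qed
  have eqs: "(a, b, n) = (3, 1, 2) \<longleftrightarrow> D = 1 \<and> A = 3 \<and> \<beta> = 1 \<and> N = 2"
    "(a, b, n) = (2, -1, 3) \<longleftrightarrow> D = 1 \<and> A = 2 \<and> \<beta> = -1 \<and> N = 3"
    "(a, b, n) = (2, 1, 3) \<longleftrightarrow> D = 1 \<and> A = 2 \<and> \<beta> = 1 \<and> N = 3"
    using unit[of \<beta>] by (auto simp: a b DAN)
  show ?thesis
  proof (intro conjI impI)
    assume ne: "\<beta> \<noteq> \<alpha>"
    show "n ^ nat a dvd a ^ nat n - b ^ nat n \<and> n ^ nat \<alpha> dvd \<alpha> ^ nat n - \<beta> ^ nat n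
             \<longleftrightarrow> (a, b, n) = (3, 1, 2) \<or> (a, b, n) = (2, -1, 3)"
      unfolding eqs na unfolding a b DAN
      using dvd_power_diff_iff[OF pos cop' bnd' ev' ne[unfolded DAN]] by blast
  next
    assume ne: "odd n \<longrightarrow> \<beta> \<noteq> - \<alpha>"
    show "n ^ nat a dvd a ^ nat n + b ^ nat n \<and> n ^ nat \<alpha> dvd \<alpha> ^ nat n + \<beta> ^ nat n
             \<longleftrightarrow> (a, b, n) = (2, 1, 3) \<or> (\<exists>c\<in>{0, 1, 2 :: nat}. (a, b, n) = (2 ^ c, 2 ^ c, 2))"
    proof (cases "even N")
      case True
      \<comment> \<open>Equality makes \<open>A\<close> coprime to itself, so \<open>A = 1\<close>
        and \<open>a\<close> is the gcd itself.\<close>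
      have eq: "b = a \<longleftrightarrow> \<beta> = 1 \<and> A = 1"
      proof
        assume "b = a"
        then have "\<beta> = int A" using a b \<open>\<delta> > 0\<close> DAN by simp
        then show "\<beta> = 1 \<and> A = 1" using cop' pos by simp
      qed (simp add: a b DAN)
      have "(\<exists>c\<in>{0, 1, 2 :: nat}. (a, b, n) = (2 ^ c, 2 ^ c, 2)) \<longleftrightarrow> a \<in> {1, 2, 4} \<and> b = a \<and> n = 2"
        by auto
      also have "\<dots> \<longleftrightarrow> D \<in> {1, 2, 4} \<and> A = 1 \<and> \<beta> = 1 \<and> N = 2"
        unfolding eq unfolding a DAN by auto
      finally have powers: "(\<exists>c\<in>{0, 1, 2 :: nat}. (a, b, n) = (2 ^ c, 2 ^ c, 2))
          \<longleftrightarrow> D \<in> {1, 2, 4} \<and> A = 1 \<and> \<beta> = 1 \<and> N = 2" .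
      have no3: "\<not> (D = 1 \<and> A = 2 \<and> \<beta> = 1 \<and> N = 3)" using True by auto
      have "\<beta> \<le> int A" using bnd' by simp
      note plus = dvd_power_sum_even_iff[OF pos cop' this True ev'[OF True]]
      show ?thesis
        unfolding powers eqs na unfolding a b DAN unfolding plus using no3 by blast
    next
      case False
      \<comment> \<open>As \<open>N\<close> is odd, replacing \<open>\<beta>\<close> by
        \<open>- \<beta>\<close> turns the sum into a difference, and the excluded case
        \<open>\<beta> = - \<alpha>\<close> into equality. The solution with \<open>N = 2\<close>
        drops out.\<close>
      have "coprime (int A) (- \<beta>)" "\<bar>- \<beta>\<bar> \<le> int A" "- \<beta> \<noteq> int A"
        using cop' bnd' ne False DAN by auto
      from dvd_power_diff_iff[OF pos this(1,2) _ this(3)] False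
      have "int N ^ (D * A) dvd (int D * int A) ^ N + (int D * \<beta>) ^ N \<and> int N ^ A dvd int A ^ N + \<beta> ^ N
          \<longleftrightarrow> D = 1 \<and> (A = 3 \<and> - \<beta> = 1 \<and> N = 2 \<or> A = 2 \<and> - \<beta> = -1 \<and> N = 3)"
        by simp
      moreover have "N \<noteq> 2" "- \<beta> = -1 \<longleftrightarrow> \<beta> = 1" using False by auto
      moreover have "\<not> (\<exists>c\<in>{0, 1, 2 :: nat}. (a, b, n) = (2 ^ c, 2 ^ c, 2))"
        using \<open>N \<noteq> 2\<close> DAN by auto
      ultimately show ?thesis
        unfolding eqs na unfolding a b DAN by blast
    qed
  qed
qed

end
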